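(* Let $N'$ and $N$ be lattice path matroids on $[n]$, with Grassmann necklaces $I',I$ and Grassmann conecklaces $J',J$, respectively. Then $N'$ is a quotient of $N$ if and only if $I'_i\subseteq I_i$ and $J'_i\subseteq J_i$ for all $i\in[n]$.
   Context: For $i\in[n]$ the cyclic order $<_i$ on $[n]$ is $i<_i i+1<_i\cdots<_i n<_i 1<_i\cdots<_i i-1$; for $k$-element sets $A,B$, $A\leq_i B$ (Gale order) means the $t$-th smallest element of $A$ under $<_i$ is $\leq_i$ the $t$-th smallest element of $B$ under $<_i$, for all $t$. For $U,L\in\binom{[n]}{k}$ with $U\leq_1 L$, the lattice path matroid $M[U,L]$ is the matroid on $[n]$ whose bases are all $B\in\binom{[n]}{k}$ with $U\leq_1 B\leq_1 L$. For a matroid on $[n]$ whose bases form a positroid (lattice path matroids are positroids), the Grassmann necklace is $(I_1,\dots,I_n)$ with $I_i$ the unique $\leq_i$-minimum basis, and the Grassmann conecklace is $(J_1,\dots,J_n)$ with $J_i$ the unique $\leq_i$-maximum basis. A matroid $M$ is a quotient of $N$ on the same ground set if every circuit of $N$ is a union of circuits of $M$. *)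

theory Defs
  imports Main
begin

section \<open>Matroids and quotients\<close>

text \<open>A matroid is given by its ground set and its family of bases.\<close>

locale matroid =
  fixes E :: "'a set" and \<B> :: "'a set set"
  assumes finite_ground: "finite E"
    and bases_subset: "B \<in> \<B> \<Longrightarrow> B \<subseteq> E"
    and bases_nonempty: "\<B> \<noteq> {}"
    and basis_exchange:
      "\<lbrakk>A \<in> \<B>; B \<in> \<B>; a \<in> A - B\<rbrakk> \<Longrightarrow> \<exists>b\<in>B - A. insert b (A - {a}) \<in> \<B>"

definition dependent_in :: "'a set \<Rightarrow> 'a set set \<Rightarrow> 'a set \<Rightarrow> bool" where
  "dependent_in E \<B> X \<longleftrightarrow> X \<subseteq> E \<and> \<not> (\<exists>B\<in>\<B>. X \<subseteq> B)"

definition circuits :: "'a set \<Rightarrow> 'a set set \<Rightarrow> 'a set set" where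
  "circuits E \<B> = {C. dependent_in E \<B> C \<and> (\<forall>X. X \<subset> C \<longrightarrow> \<not> dependent_in E \<B> X)}"

definition matroid_quotient :: "'a set \<Rightarrow> 'a set set \<Rightarrow> 'a set set \<Rightarrow> bool" where
  "matroid_quotient E \<M> \<N> \<longleftrightarrow> matroid E \<M> \<and> matroid E \<N> \<and>
     (\<forall>C\<in>circuits E \<N>. \<exists>\<C>. \<C> \<subseteq> circuits E \<M> \<and> C = \<Union>\<C>)"


section \<open>Cyclic orders and Gale orders\<close>

text \<open>
  The order \<open>i < i+1 < \<dots> < n < 1 < \<dots> < i-1\<close>: the elements \<open>\<ge> i\<close> precede
  those \<open>< i\<close>, and each of the two blocks carries the usual order. In this form
  \<open>n\<close> need not be a parameter; the relation is used on \<open>{1..n}\<close> only.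
\<close>

definition cyc_less :: "nat \<Rightarrow> nat \<Rightarrow> nat \<Rightarrow> bool" where
  "cyc_less i a b \<longleftrightarrow> (if (i \<le> a) = (i \<le> b) then a < b else i \<le> a)"

definition cyc_le :: "nat \<Rightarrow> nat \<Rightarrow> nat \<Rightarrow> bool" where
  "cyc_le i a b \<longleftrightarrow> a = b \<or> cyc_less i a b"

text \<open>The \<open>t\<close>-th smallest element of \<open>A\<close>, with \<open>t\<close> counted from 1.\<close>

definition nth_smallest :: "nat \<Rightarrow> nat set \<Rightarrow> nat \<Rightarrow> nat" where
  "nth_smallest i A t = (THE x. x \<in> A \<and> card {y \<in> A. cyc_le i y x} = t)"

definition gale_le :: "nat \<Rightarrow> nat set \<Rightarrow> nat set \<Rightarrow> bool" where
  "gale_le i A B \<longleftrightarrow> card A = card B \<and>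
     (\<forall>t\<in>{1..card A}. cyc_le i (nth_smallest i A t) (nth_smallest i B t))"


section \<open>Lattice path matroids, necklaces and conecklaces\<close>

definition lpm_bases :: "nat \<Rightarrow> nat set \<Rightarrow> nat set \<Rightarrow> nat set set" where
  "lpm_bases n U L =
     {B. B \<subseteq> {1..n} \<and> card B = card U \<and> gale_le 1 U B \<and> gale_le 1 B L}"

definition lattice_path_matroid :: "nat \<Rightarrow> nat set set \<Rightarrow> bool" where
  "lattice_path_matroid n \<B> \<longleftrightarrow>
     (\<exists>k U L. U \<subseteq> {1..n} \<and> card U = k \<and> L \<subseteq> {1..n} \<and> card L = k \<and>
        gale_le 1 U L \<and> \<B> = lpm_bases n U L)"

text \<open>
  The descriptions below determine unique bases whenever \<open>\<B>\<close> is the family of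
  bases of a matroid on \<open>{1..n}\<close> and \<open>i \<in> {1..n}\<close>.
\<close>

definition grassmann_necklace :: "nat set set \<Rightarrow> nat \<Rightarrow> nat set" where
  "grassmann_necklace \<B> i = (THE I. I \<in> \<B> \<and> (\<forall>B\<in>\<B>. gale_le i I B))"

definition grassmann_conecklace :: "nat set set \<Rightarrow> nat \<Rightarrow> nat set" where
  "grassmann_conecklace \<B> i = (THE J. J \<in> \<B> \<and> (\<forall>B\<in>\<B>. gale_le i B J))"


section \<open>Lattice path matroids are matroids\<close>

definition cnt :: "nat set \<Rightarrow> nat \<Rightarrow> nat" where
  "cnt A j = card (A \<inter> {..j})"

lemma cyc_le_1: "1 \<le> a \<Longrightarrow> 1 \<le> b \<Longrightarrow> cyc_le 1 a b \<longleftrightarrow> a \<le> b"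
  by (auto simp: cyc_le_def cyc_less_def)

lemma cnt_mono: "finite A \<Longrightarrow> j \<le> j' \<Longrightarrow> cnt A j \<le> cnt A j'"
  unfolding cnt_def by (rule card_mono) auto

lemma cnt_strict: "finite A \<Longrightarrow> x \<in> A \<Longrightarrow> j < x \<Longrightarrow> cnt A j < cnt A x"
  unfolding cnt_def
proof (rule psubset_card_mono)
  assume "finite A" "x \<in> A" "j < x"
  then have "A \<inter> {..j} \<subseteq> A \<inter> {..x}" "x \<in> A \<inter> {..x}" "x \<notin> A \<inter> {..j}" by auto
  then show "A \<inter> {..j} \<subset> A \<inter> {..x}" by blast
qed simp

lemma cnt_0: "A \<subseteq> {1..n} \<Longrightarrow> cnt A 0 = 0"
  unfolding cnt_def by (auto simp: card_eq_0_iff)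

lemma cnt_top: "A \<subseteq> {1..n} \<Longrightarrow> n \<le> j \<Longrightarrow> cnt A j = card A"
  unfolding cnt_def by (rule arg_cong[where f = card]) auto

lemma cnt_Suc: "cnt A (Suc j) = (if Suc j \<in> A then Suc (cnt A j) else cnt A j)"
proof -
  have "A \<inter> {..Suc j} = (if Suc j \<in> A then insert (Suc j) (A \<inter> {..j}) else A \<inter> {..j})"
    by (auto simp: le_Suc_eq)
  then show ?thesis by (auto simp: cnt_def)
qed

lemma nth_smallest_1:
  assumes A: "A \<subseteq> {1..n}" and t: "1 \<le> t" "t \<le> card A"
  shows "nth_smallest 1 A t \<in> A" and "nth_smallest 1 A t \<le> j \<longleftrightarrow> t \<le> cnt A j"
proof -
  have fin: "finite A" using A finite_subset by blast
  define x where "x = (LEAST j. t \<le> cnt A j)"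
  have tx: "t \<le> cnt A x"
    unfolding x_def by (rule LeastI[of _ n]) (use cnt_top[OF A, of n] t in simp)
  then obtain m where m: "x = Suc m"
    using cnt_0[OF A] t by (cases x) auto
  have "\<not> t \<le> cnt A m"
    using m not_less_Least[of m "\<lambda>j. t \<le> cnt A j"] unfolding x_def by simp
  with tx m have xA: "x \<in> A" and cx: "cnt A x = t"
    by (auto simp: cnt_Suc split: if_splits)
  have cc: "card {y \<in> A. cyc_le 1 y z} = cnt A z" if "z \<in> A" for z
  proof -
    have "cyc_le 1 y z \<longleftrightarrow> y \<le> z" if "y \<in> A" for y
      using that \<open>z \<in> A\<close> A by (intro cyc_le_1) auto
    then have "{y \<in> A. cyc_le 1 y z} = A \<inter> {..z}" by auto
    then show ?thesis by (simp add: cnt_def)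
  qed
  have "nth_smallest 1 A t = x"
    unfolding nth_smallest_def
  proof (rule the_equality)
    show "x \<in> A \<and> card {y \<in> A. cyc_le 1 y x} = t" using xA cx cc by simp
  next
    fix z assume z: "z \<in> A \<and> card {y \<in> A. cyc_le 1 y z} = t"
    then have "cnt A z = t" using cc[of z] by metis
    with z xA cx cnt_strict[OF fin, of x z] cnt_strict[OF fin, of z x] show "z = x"
      by (cases z x rule: linorder_cases) auto
  qed
  moreover have "x \<le> j \<longleftrightarrow> t \<le> cnt A j"
    using cnt_mono[OF fin, of x j] cx Least_le[of "\<lambda>j. t \<le> cnt A j" j]
    unfolding x_def by auto
  ultimately show "nth_smallest 1 A t \<in> A" "nth_smallest 1 A t \<le> j \<longleftrightarrow> t \<le> cnt A j"
    using xA by auto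
qed

lemma gale_le_1_iff:
  assumes A: "A \<subseteq> {1..n}" and B: "B \<subseteq> {1..n}" and k: "card A = card B"
  shows "gale_le 1 A B \<longleftrightarrow> (\<forall>j. cnt B j \<le> cnt A j)"
proof -
  have le: "cyc_le 1 (nth_smallest 1 A t) (nth_smallest 1 B t) \<longleftrightarrow>
      (\<forall>j. t \<le> cnt B j \<longrightarrow> t \<le> cnt A j)" if "t \<in> {1..card A}" for t
  proof -
    have t: "1 \<le> t" "t \<le> card A" "t \<le> card B" using that k by auto
    note a = nth_smallest_1[OF A t(1,2)] and b = nth_smallest_1[OF B t(1,3)]
    have "cyc_le 1 (nth_smallest 1 A t) (nth_smallest 1 B t) \<longleftrightarrow>
        nth_smallest 1 A t \<le> nth_smallest 1 B t"
      using a(1) b(1) A B by (intro cyc_le_1) auto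
    also have "\<dots> \<longleftrightarrow> (\<forall>j. nth_smallest 1 B t \<le> j \<longrightarrow> nth_smallest 1 A t \<le> j)"
      by (auto intro: order_trans)
    finally show ?thesis using a(2) b(2) by simp
  qed
  have fin: "finite B" using B finite_subset by blast
  have "cnt B j \<le> card A" for j
    unfolding cnt_def k by (rule card_mono) (use fin in auto)
  then have "(\<forall>t\<in>{1..card A}. \<forall>j. t \<le> cnt B j \<longrightarrow> t \<le> cnt A j) \<longleftrightarrow>
      (\<forall>j. cnt B j \<le> cnt A j)"
  proof (intro iffI allI ballI impI)
    fix j assume bound: "\<And>j. cnt B j \<le> card A"
      and *: "\<forall>t\<in>{1..card A}. \<forall>j. t \<le> cnt B j \<longrightarrow> t \<le> cnt A j"
    show "cnt B j \<le> cnt A j"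
    proof (cases "cnt B j = 0")
      case False
      then have "cnt B j \<in> {1..card A}" using bound[of j] by simp
      then show ?thesis using * by blast
    qed simp
  next
    fix t j assume "\<forall>j. cnt B j \<le> cnt A j" "t \<le> cnt B j"
    then show "t \<le> cnt A j" by (meson order_trans)
  qed
  then show ?thesis using le k by (simp add: gale_le_def)
qed

lemma lpm_bases_iff:
  assumes "U \<subseteq> {1..n}" "L \<subseteq> {1..n}" "card L = card U"
  shows "B \<in> lpm_bases n U L \<longleftrightarrow>
    B \<subseteq> {1..n} \<and> card B = card U \<and> (\<forall>j. cnt B j \<le> cnt U j) \<and> (\<forall>j. cnt L j \<le> cnt B j)"
  using gale_le_1_iff[of U n B] gale_le_1_iff[of B n L] assms
  unfolding lpm_bases_def by auto

lemma cnt_swap: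
  assumes fin: "finite A" and a: "a \<in> A" and b: "b \<notin> A"
  shows "cnt (insert b (A - {a})) j + (if a \<le> j then 1 else 0) =
    cnt A j + (if b \<le> j then 1 else 0)"
proof -
  have "(insert b (A - {a})) \<inter> {..j} =
      (if b \<le> j then insert b (A \<inter> {..j} - {a}) else A \<inter> {..j} - {a})"
    by auto
  moreover have "card (A \<inter> {..j} - {a}) + (if a \<le> j then 1 else 0) = card (A \<inter> {..j})"
  proof (cases "a \<le> j")
    case True
    then have "a \<in> A \<inter> {..j}" using a by simp
    then have "card (A \<inter> {..j}) = Suc (card (A \<inter> {..j} - {a}))"
      by (intro card.remove) auto
    then show ?thesis using True by simp
  qed simp
  ultimately show ?thesis using b by (auto simp: cnt_def)
qed

lemma cnt_split: "j \<le> j' \<Longrightarrow> cnt A j' = cnt A j + card (A \<inter> {j<..j'})"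
proof -
  assume "j \<le> j'"
  then have "A \<inter> {..j'} = (A \<inter> {..j}) \<union> (A \<inter> {j<..j'})" by auto
  then show ?thesis by (simp add: cnt_def card_Un_disjoint disjoint_iff)
qed

theorem lattice_path_matroid_matroid:
  assumes "lattice_path_matroid n \<B>"
  shows "matroid {1..n} \<B>"
proof -
  obtain U L where U: "U \<subseteq> {1..n}" and L: "L \<subseteq> {1..n}" and k: "card L = card U"
    and UL: "gale_le 1 U L" and \<B>: "\<B> = lpm_bases n U L"
    using assms unfolding lattice_path_matroid_def by auto
  note iff = lpm_bases_iff[OF U L k]
  show ?thesis
  proof
    show "finite {1..n}" by simp
    show "B \<subseteq> {1..n}" if "B \<in> \<B>" for B using that \<B> iff by simp
    have "U \<in> \<B>" using \<B> iff U UL gale_le_1_iff[OF U L] k by simp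
    then show "\<B> \<noteq> {}" by auto
    fix A B a assume "A \<in> \<B>" "B \<in> \<B>" and a: "a \<in> A - B"
    then have A: "A \<subseteq> {1..n}" "card A = card U" "\<And>j. cnt A j \<le> cnt U j" "\<And>j. cnt L j \<le> cnt A j"
      and B: "B \<subseteq> {1..n}" "card B = card U" "\<And>j. cnt B j \<le> cnt U j" "\<And>j. cnt L j \<le> cnt B j"
      using \<B> iff by auto
    have fin: "finite A" using A(1) finite_subset by blast
    have an: "1 \<le> a" "a \<le> n" using a A(1) by auto
    define hi where "hi = (LEAST j. a \<le> j \<and> cnt A j = cnt L j)"
    have "a \<le> n \<and> cnt A n = cnt L n" using an A k L cnt_top by simp
    then have "a \<le> hi \<and> cnt A hi = cnt L hi"
      unfolding hi_def by (rule LeastI)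
    then have hi: "a \<le> hi" "cnt A hi = cnt L hi" by auto
    have hi_lt: "cnt L j < cnt A j" if "a \<le> j" "j < hi" for j
      using not_less_Least[of j "\<lambda>j. a \<le> j \<and> cnt A j = cnt L j"] that A(4)[of j]
      unfolding hi_def by force
    define S where "S = {j. j < a \<and> cnt A j = cnt U j}"
    define lo where "lo = Max S"
    have fS: "finite S" unfolding S_def by simp
    have "0 \<in> S" unfolding S_def using an cnt_0[OF A(1)] cnt_0[OF U] by simp
    then have "lo \<in> S" unfolding lo_def using fS Max_in by blast
    then have lo: "lo < a" "cnt A lo = cnt U lo" unfolding S_def by auto
    have lo_lt: "cnt A j < cnt U j" if "lo < j" "j < a" for j
    proof -
      have "j \<notin> S" using Max_ge[OF fS, of j] that unfolding lo_def by auto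
      then show ?thesis using that A(3)[of j] unfolding S_def by auto
    qed
    have "\<exists>b\<in>B - A. lo < b \<and> b \<le> hi"
    proof (rule ccontr)
      assume "\<not> ?thesis"
      then have "B \<inter> {lo<..hi} \<subset> A \<inter> {lo<..hi}"
        using a lo hi by auto
      then have "card (B \<inter> {lo<..hi}) < card (A \<inter> {lo<..hi})"
        by (rule psubset_card_mono[rotated]) simp
      moreover have "lo \<le> hi" using lo hi by simp
      ultimately show False
        using cnt_split[of lo hi A] cnt_split[of lo hi B] B(3)[of lo] B(4)[of hi] lo hi by simp
    qed
    then obtain b where b: "b \<in> B - A" "lo < b" "b \<le> hi" by auto
    have ab: "a \<in> A" "b \<notin> A" "a \<noteq> b" using a b by auto
    let ?A = "insert b (A - {a})"
    note swap = cnt_swap[OF fin ab(1,2)]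
    have "cnt ?A j \<le> cnt U j" for j
      using swap[of j] A(3)[of j] lo_lt[of j] b by (auto split: if_splits)
    moreover have "cnt L j \<le> cnt ?A j" for j
      using swap[of j] A(4)[of j] hi_lt[of j] b by (auto split: if_splits)
    moreover have "?A \<subseteq> {1..n}" using A(1) B(1) b by auto
    moreover have "card ?A = card U"
      using A(2) fin ab card_Suc_Diff1[OF fin ab(1)] by simp
    ultimately have "?A \<in> \<B>" using \<B> iff by simp
    then show "\<exists>b\<in>B - A. insert b (A - {a}) \<in> \<B>" using b by blast
  qed
qed

end

theory Submission
  imports Defs
begin

text \<open>
  For a linear order on the ground set, the Gale-minimal basis consists of the elements that are
  not the last element of a circuit; if every circuit of \<open>N\<close> is a union of circuits of \<open>N'\<close>, the
  minimal basis of \<open>N'\<close> is therefore contained in that of \<open>N\<close>. Reversing the cyclic order gives the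
  same for conecklaces.

  Conversely, write \<open>u j\<close>, \<open>l j\<close> for the numbers of elements \<open>\<le> j\<close> of \<open>U\<close>, \<open>L\<close>, and likewise with
  primes. A set \<open>X\<close> is independent in \<open>M[U,L]\<close> iff it has at most \<open>u b - l a\<close> elements in every
  interval \<open>{a<..b}\<close>, so a circuit \<open>C\<close> of \<open>N\<close> has \<open>u b - l a + 1\<close> elements for some \<open>{a<..b}\<close>
  containing it. Suppose that no circuit of \<open>N'\<close> inside \<open>C\<close> contains \<open>e \<in> C\<close>, and let \<open>X\<close> be a
  maximal \<open>N'\<close>-independent subset of \<open>C\<close>, so \<open>e \<in> X\<close>. Every element of \<open>C - X\<close> lies in an interval
  \<open>{c<..d}\<close> avoiding \<open>e\<close> that is tight for \<open>X\<close> in \<open>N'\<close>; it contains at most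
  \<open>(u d - u' d) - (l c - l' c)\<close> elements of \<open>C - X\<close>. By the necklace inclusions these estimates can be
  chained over consecutive tight intervals, giving \<open>card (C - X) \<le> (u b - u' b) - (l a - l' a)\<close>,
  which contradicts the independence of \<open>X\<close>.
\<close>

section \<open>Gale-minimal bases and circuits\<close>

definition indep :: "'a set set \<Rightarrow> 'a set \<Rightarrow> bool" where
  "indep \<B> X \<longleftrightarrow> (\<exists>B\<in>\<B>. X \<subseteq> B)"

lemma indep_mono: "indep \<B> Y \<Longrightarrow> X \<subseteq> Y \<Longrightarrow> indep \<B> X"
  unfolding indep_def by blast

lemma dependent_in_iff: "dependent_in E \<B> X \<longleftrightarrow> X \<subseteq> E \<and> \<not> indep \<B> X"
  unfolding dependent_in_def indep_def by simp

lemma circuits_iff: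
  "C \<in> circuits E \<B> \<longleftrightarrow> C \<subseteq> E \<and> \<not> indep \<B> C \<and> (\<forall>X. X \<subset> C \<longrightarrow> indep \<B> X)"
  unfolding circuits_def dependent_in_iff by auto

lemma dependent_contains_circuit:
  assumes "finite E" "X \<subseteq> E" "\<not> indep \<B> X"
  obtains C where "C \<in> circuits E \<B>" "C \<subseteq> X"
proof -
  let ?P = "\<lambda>Y. Y \<subseteq> X \<and> \<not> indep \<B> Y"
  have "finite {Y. ?P Y}"
    using finite_subset[OF assms(2,1)] by simp
  moreover have "X \<in> {Y. ?P Y}" using assms by simp
  ultimately obtain C where C: "C \<in> {Y. ?P Y}"
    and min: "\<And>Y. Y \<in> {Y. ?P Y} \<Longrightarrow> Y \<subseteq> C \<Longrightarrow> C = Y"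
    using finite_has_minimal2[of "{Y. ?P Y}" X] by (metis (lifting))
  have "C \<in> circuits E \<B>" "C \<subseteq> X"
    using C min assms(2) unfolding circuits_iff by blast+
  then show thesis by (rule that)
qed

text \<open>The Gale minimum for the order given by the weights, with the comparison of
  \<open>t\<close>-th smallest elements rephrased as counting in initial segments. An arbitrary
  \<open>w\<close> covers cyclic orders and their reversals, hence necklaces and conecklaces
  alike.\<close>

definition first_basis :: "('a \<Rightarrow> nat) \<Rightarrow> 'a set set \<Rightarrow> 'a set \<Rightarrow> bool" where
  "first_basis w \<B> I \<longleftrightarrow>
     I \<in> \<B> \<and> (\<forall>B\<in>\<B>. \<forall>m. card {y \<in> B. w y \<le> m} \<le> card {y \<in> I. w y \<le> m})"

section \<open>Exchange arguments and greedy bases\<close>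

context matroid
begin

lemma finite_basis: "B \<in> \<B> \<Longrightarrow> finite B"
  using bases_subset finite_ground finite_subset by blast

lemma card_bases_eq:
  assumes "A \<in> \<B>" "B \<in> \<B>"
  shows "card A = card B"
  using assms
proof (induction "card (A - B)" arbitrary: A rule: less_induct)
  case less
  show ?case
  proof (cases "A - B = {}")
    case True
    with basis_exchange[OF less.prems(2,1)] have "A = B" by blast
    then show ?thesis by simp
  next
    case False
    then obtain a where a: "a \<in> A - B" by blast
    obtain b where b: "b \<in> B - A" "insert b (A - {a}) \<in> \<B>"
      using basis_exchange[OF less.prems a] ..
    have fin: "finite A" using finite_basis less.prems by blast
    have "insert b (A - {a}) - B \<subset> A - B" using a b(1) by auto
    then have "card (insert b (A - {a}) - B) < card (A - B)"
      using fin by (intro psubset_card_mono) auto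
    then have "card (insert b (A - {a})) = card B"
      using less.hyps b(2) less.prems(2) by blast
    moreover have "card (insert b (A - {a})) = card A"
      using a b fin card_Suc_Diff1[OF fin, of a] by simp
    ultimately show ?thesis by simp
  qed
qed

lemma extend_to_basis:
  assumes "indep \<B> X" "B \<in> \<B>"
  obtains B' where "B' \<in> \<B>" "X \<subseteq> B'" "B' \<subseteq> X \<union> B"
proof -
  obtain A0 where "A0 \<in> \<B> \<and> X \<subseteq> A0" using assms(1) unfolding indep_def by blast
  \<comment> \<open>A basis containing \<open>X\<close> with fewest elements outside
    \<open>X \<union> B\<close> has none there: exchanging such an element against \<open>B\<close>
    would lower their number.\<close>
  then obtain A where A: "A \<in> \<B>" "X \<subseteq> A"
    and min: "\<And>D. D \<in> \<B> \<Longrightarrow> X \<subseteq> D \<Longrightarrow> card (A - (X \<union> B)) \<le> card (D - (X \<union> B))"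
    using ex_has_least_nat[of "\<lambda>A. A \<in> \<B> \<and> X \<subseteq> A" A0 "\<lambda>A. card (A - (X \<union> B))"] by metis
  have "A \<subseteq> X \<union> B"
  proof (rule ccontr)
    assume "\<not> ?thesis"
    then obtain a where a: "a \<in> A - B" "a \<notin> X" by blast
    obtain b where b: "b \<in> B - A" "insert b (A - {a}) \<in> \<B>"
      using basis_exchange[OF A(1) assms(2) a(1)] by blast
    have "insert b (A - {a}) - (X \<union> B) \<subset> A - (X \<union> B)" using a b(1) by auto
    then have "card (insert b (A - {a}) - (X \<union> B)) < card (A - (X \<union> B))"
      using finite_basis[OF A(1)] by (intro psubset_card_mono) auto
    moreover have "X \<subseteq> insert b (A - {a})" using A a by blast
    ultimately show False using min[OF b(2)] by simp
  qed
  then show thesis using that A by blast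
qed

lemma indep_augment:
  assumes "indep \<B> X" "indep \<B> Y" "card X < card Y"
  obtains y where "y \<in> Y - X" "indep \<B> (insert y X)"
proof -
  obtain B where B: "B \<in> \<B>" "Y \<subseteq> B" using assms(2) unfolding indep_def by blast
  obtain B' where B': "B' \<in> \<B>" "X \<subseteq> B'" "B' \<subseteq> X \<union> B"
    using extend_to_basis[OF assms(1) B(1)] .
  have fin: "finite B" "finite B'" using finite_basis B B' by auto
  have finX: "finite X" using B'(2) fin(2) finite_subset by blast
  have "B' \<inter> (Y - X) \<noteq> {}"
  proof
    assume "B' \<inter> (Y - X) = {}"
    then have "B' \<subseteq> X \<union> (B - Y)" using B' by blast
    then have "card B' \<le> card (X \<union> (B - Y))"
      using fin finX by (intro card_mono) auto
    also have "\<dots> \<le> card X + card (B - Y)" by (rule card_Un_le)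
    also have "\<dots> = card X + (card B - card Y)"
      using B(2) fin finite_subset by (metis card_Diff_subset)
    finally show False
      using card_bases_eq[OF B(1) B'(1)] card_mono[OF fin(1) B(2)] assms(3) by simp
  qed
  then show thesis using that B' unfolding indep_def by blast
qed

text \<open>A basis of least total weight works: if some \<open>B\<close> had more elements up to
  level \<open>m\<close>, augmentation would replace an element of weight above \<open>m\<close> by
  one of weight at most \<open>m\<close>.\<close>

lemma first_basis_exists: "\<exists>I. first_basis w \<B> I"
proof -
  obtain I where I: "I \<in> \<B>" and min: "\<And>D. D \<in> \<B> \<Longrightarrow> sum w I \<le> sum w D"
    using ex_has_least_nat[of "\<lambda>A. A \<in> \<B>" _ "sum w"] bases_nonempty by blast
  have "card {y \<in> B. w y \<le> m} \<le> card {y \<in> I. w y \<le> m}" if B: "B \<in> \<B>" for B m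
  proof (rule ccontr)
    assume "\<not> ?thesis"
    moreover have "indep \<B> {y \<in> I. w y \<le> m}" "indep \<B> {y \<in> B. w y \<le> m}"
      using I B unfolding indep_def by blast+
    ultimately obtain y where y: "y \<in> {y \<in> B. w y \<le> m} - {y \<in> I. w y \<le> m}"
      and ind: "indep \<B> (insert y {y \<in> I. w y \<le> m})"
      using indep_augment[of "{y \<in> I. w y \<le> m}" "{y \<in> B. w y \<le> m}"] by auto
    obtain D where D: "D \<in> \<B>" "insert y {y \<in> I. w y \<le> m} \<subseteq> D"
      "D \<subseteq> insert y {y \<in> I. w y \<le> m} \<union> I"
      using extend_to_basis[OF ind I] .
    have fin: "finite I" "finite D" using finite_basis I D by auto
    have yI: "y \<notin> I" "w y \<le> m" using y by auto
    have "D - {y} \<subseteq> I" using D by blast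
    moreover have "card (I - (D - {y})) = 1"
    proof -
      have "card (D - {y}) = card I - 1"
        using card_bases_eq[OF I D(1)] D(2) fin by simp
      moreover have "card I > 0"
        using card_bases_eq[OF I D(1)] D(2) fin by (auto simp: card_gt_0_iff)
      moreover have "card (I - (D - {y})) = card I - card (D - {y})"
        using \<open>D - {y} \<subseteq> I\<close> fin by (intro card_Diff_subset) auto
      ultimately show ?thesis by linarith
    qed
    then obtain x where x: "I - (D - {y}) = {x}" by (auto simp: card_1_singleton_iff)
    ultimately have I_eq: "I = insert x (D - {y})" and xD: "x \<notin> D - {y}" and xI: "x \<in> I" by blast+
    have "\<not> w x \<le> m" using D(2) xD xI yI by auto
    moreover have "sum w I = w x + sum w (D - {y})"
      unfolding I_eq using fin xD by (subst sum.insert) auto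
    moreover have "sum w D = w y + sum w (D - {y})"
      using fin D(2) by (intro sum.remove) auto
    ultimately show False using min[OF D(1)] yI by simp
  qed
  then show ?thesis using I unfolding first_basis_def by blast
qed

text \<open>Expresses the first basis through circuits alone, which makes it comparable between a
  matroid and its quotient.\<close>

lemma first_basis_eq:
  assumes inj: "inj_on w E" and fb: "first_basis w \<B> I"
  shows "I = {e \<in> E. \<not> (\<exists>C\<in>circuits E \<B>. e \<in> C \<and> (\<forall>y\<in>C. w y \<le> w e))}"
proof -
  have I: "I \<in> \<B>" and le: "\<And>B m. B \<in> \<B> \<Longrightarrow> card {y \<in> B. w y \<le> m} \<le> card {y \<in> I. w y \<le> m}"
    using fb unfolding first_basis_def by auto
  have IE: "I \<subseteq> E" and fin: "finite I" using bases_subset finite_basis I by auto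
  have "\<exists>C\<in>circuits E \<B>. e \<in> C \<and> (\<forall>y\<in>C. w y \<le> w e)" if e: "e \<in> E" "e \<notin> I" for e
  proof -
    let ?X = "{y \<in> I. w y \<le> w e}"
    \<comment> \<open>A basis containing this set would have more elements than \<open>I\<close> up
      to level \<open>w e\<close>. The circuit found below passes through \<open>e\<close>, since
      the rest of the set lies in \<open>I\<close>.\<close>
    have dep: "\<not> indep \<B> (insert e ?X)"
    proof
      assume "indep \<B> (insert e ?X)"
      then obtain B where B: "B \<in> \<B>" "insert e ?X \<subseteq> B" unfolding indep_def by blast
      have "card (insert e ?X) \<le> card {y \<in> B. w y \<le> w e}"
        using B finite_basis[OF B(1)] by (intro card_mono) auto
      then show False using le[OF B(1), of "w e"] e fin by simp
    qed
    have "insert e ?X \<subseteq> E" using e IE by auto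
    then obtain C where C: "C \<in> circuits E \<B>" "C \<subseteq> insert e ?X"
      using dep by (rule dependent_contains_circuit[OF finite_ground])
    have "\<not> C \<subseteq> I" using C(1) I unfolding circuits_iff indep_def by blast
    then have "e \<in> C" using C(2) by blast
    then show ?thesis using C by blast
  qed
  moreover have False
    if e: "e \<in> I" and C: "C \<in> circuits E \<B>" "e \<in> C" "\<And>y. y \<in> C \<Longrightarrow> w y \<le> w e" for e C
  proof -
    have ind: "indep \<B> (C - {e})" and "\<not> indep \<B> C" "C \<subseteq> E"
      using C unfolding circuits_iff by auto
    \<comment> \<open>Above level \<open>w e\<close>, \<open>B\<close> has only elements of
      \<open>I\<close>. At that level only \<open>e\<close> can occur, and \<open>B\<close> misses
      it, so comparing strictly below gives \<open>B\<close> fewer elements up to it than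
      \<open>I\<close>, against equal cardinality.\<close>
    obtain B where B: "B \<in> \<B>" "C - {e} \<subseteq> B" "B \<subseteq> (C - {e}) \<union> I"
      using extend_to_basis[OF ind I] .
    have finB: "finite B" using finite_basis B by blast
    have eB: "e \<notin> B" using \<open>\<not> indep \<B> C\<close> B(1,2) unfolding indep_def by blast
    let ?hi = "\<lambda>A. {y \<in> A. \<not> w y \<le> w e}"
    have split: "card A = card {y \<in> A. w y \<le> w e} + card (?hi A)" if "finite A" for A
    proof -
      have "A = {y \<in> A. w y \<le> w e} \<union> ?hi A" by blast
      then show ?thesis using that
        by (metis (no_types, lifting) card_Un_disjoint disjoint_iff finite_Un mem_Collect_eq)
    qed
    have lt: "{y \<in> A. w y < w e} = {y \<in> A. w y \<le> w e} - {e}" if "A \<subseteq> E" for A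
      using that inj IE e by (auto simp: inj_on_def nat_less_le)
    have "card {y \<in> B. w y \<le> w e} \<le> card ({y \<in> I. w y \<le> w e} - {e})"
    proof (cases "w e")
      case 0
      have "{y \<in> B. w y \<le> w e} = {}"
        using 0 lt[OF bases_subset[OF B(1)]] eB by auto
      then have "card {y \<in> B. w y \<le> w e} = 0" by (simp only: card.empty)
      then show ?thesis by linarith
    next
      case (Suc m)
      have "{y \<in> A. w y \<le> m} = {y \<in> A. w y \<le> w e} - {e}" if "A \<subseteq> E" for A
        using lt[OF that] Suc by (simp add: less_Suc_eq_le)
      then show ?thesis using le[OF B(1), of m] bases_subset[OF B(1)] IE eB by simp
    qed
    also have "\<dots> < card {y \<in> I. w y \<le> w e}"
      using e fin by (intro psubset_card_mono) auto
    finally have "card {y \<in> B. w y \<le> w e} < card {y \<in> I. w y \<le> w e}" .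
    moreover have "card (?hi B) \<le> card (?hi I)"
      using B(3) C(3) fin by (intro card_mono) auto
    ultimately show False
      using split[OF fin] split[OF finB] card_bases_eq[OF I B(1)] by simp
  qed
  ultimately show ?thesis using IE by blast
qed

lemma first_basis_unique:
  "inj_on w E \<Longrightarrow> first_basis w \<B> I \<Longrightarrow> first_basis w \<B> J \<Longrightarrow> I = J"
  by (rule trans[OF first_basis_eq sym[OF first_basis_eq]])

lemma first_basis_ex1: "inj_on w E \<Longrightarrow> \<exists>!I. first_basis w \<B> I"
  using first_basis_exists[of w] first_basis_unique[of w] by blast

end

section \<open>Cyclic orders and necklaces\<close>

text \<open>The rank of \<open>x\<close> in the cyclic order starting at \<open>i\<close>, counted
  from 1: on \<open>{1..n}\<close> an isomorphism to the usual order, along which the facts for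
  \<open>i = 1\<close> are transported.\<close>

definition cyc_pos :: "nat \<Rightarrow> nat \<Rightarrow> nat \<Rightarrow> nat" where
  "cyc_pos n i x = (if i \<le> x then x + 1 - i else x + n + 1 - i)"

lemma cyc_pos_range: "i \<in> {1..n} \<Longrightarrow> x \<in> {1..n} \<Longrightarrow> cyc_pos n i x \<in> {1..n}"
  by (auto simp: cyc_pos_def)

lemma cyc_pos_inj: "i \<in> {1..n} \<Longrightarrow> inj_on (cyc_pos n i) {1..n}"
  by (auto simp: inj_on_def cyc_pos_def split: if_splits)

lemma cyc_le_iff:
  "i \<in> {1..n} \<Longrightarrow> x \<in> {1..n} \<Longrightarrow> y \<in> {1..n} \<Longrightarrow>
    cyc_le i x y \<longleftrightarrow> cyc_pos n i x \<le> cyc_pos n i y"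
  by (auto simp: cyc_le_def cyc_less_def cyc_pos_def)

lemma nth_smallest_cyc_pos:
  assumes i: "i \<in> {1..n}" and A: "A \<subseteq> {1..n}" and t: "t \<in> {1..card A}"
  shows "nth_smallest i A t \<in> A"
    and "cyc_pos n i (nth_smallest i A t) = nth_smallest 1 (cyc_pos n i ` A) t"
proof -
  let ?p = "cyc_pos n i"
  have inj: "inj_on ?p A" using cyc_pos_inj[OF i] A inj_on_subset by blast
  have pA: "?p ` A \<subseteq> {1..n}" using cyc_pos_range[OF i] A by blast
  have card: "card (?p ` A) = card A" using inj by (rule card_image)
  have fin: "finite A" using A finite_subset by blast
  let ?z = "nth_smallest 1 (?p ` A) t"
  have z: "?z \<in> ?p ` A" "\<And>j. ?z \<le> j \<longleftrightarrow> t \<le> cnt (?p ` A) j"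
    using nth_smallest_1[OF pA, of t] t card by auto
  have rank: "card {y \<in> A. cyc_le i y x} = cnt (?p ` A) (?p x)" if x: "x \<in> A" for x
  proof -
    have "?p ` {y \<in> A. cyc_le i y x} = ?p ` A \<inter> {..?p x}"
      using cyc_le_iff[OF i] A x by blast
    moreover have "card (?p ` {y \<in> A. cyc_le i y x}) = card {y \<in> A. cyc_le i y x}"
      by (rule card_image) (rule inj_on_subset[OF inj], blast)
    ultimately show ?thesis by (simp add: cnt_def)
  qed
  have eq: "cnt (?p ` A) x = t \<longleftrightarrow> x = ?z" if "x \<in> ?p ` A" for x
  proof
    assume "x = ?z"
    moreover have "t \<le> cnt (?p ` A) ?z" using z(2)[of ?z] by simp
    moreover obtain m where m: "?z = Suc m" using z(1) pA by (cases ?z) auto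
    moreover have "\<not> t \<le> cnt (?p ` A) m" using z(2)[of m] m by simp
    ultimately show "cnt (?p ` A) x = t" by (simp add: cnt_Suc split: if_splits)
  next
    assume "cnt (?p ` A) x = t"
    moreover from this have "?z \<le> x" using z(2)[of x] by simp
    moreover have "t \<le> cnt (?p ` A) ?z" using z(2)[of ?z] by simp
    ultimately show "x = ?z"
      using cnt_strict[of "?p ` A" x ?z] that fin by fastforce
  qed
  obtain x where x: "x \<in> A" "?p x = ?z" using z(1) by auto
  have "nth_smallest i A t = x"
    unfolding nth_smallest_def
  proof (rule the_equality)
    show "x \<in> A \<and> card {y \<in> A. cyc_le i y x} = t" using x rank[OF x(1)] eq[OF z(1)] by simp
    fix y assume "y \<in> A \<and> card {z \<in> A. cyc_le i z y} = t"
    then have "y \<in> A" "?p y = ?p x" using x rank[of y] eq[of "?p y"] by (metis, metis imageI)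
    then show "y = x" using inj x by (simp add: inj_on_def)
  qed
  then show "nth_smallest i A t \<in> A" "?p (nth_smallest i A t) = ?z" using x by auto
qed

lemma gale_le_iff:
  assumes i: "i \<in> {1..n}" and A: "A \<subseteq> {1..n}" and B: "B \<subseteq> {1..n}" and k: "card A = card B"
  shows "gale_le i A B \<longleftrightarrow>
    (\<forall>m. card {y \<in> B. cyc_pos n i y \<le> m} \<le> card {y \<in> A. cyc_pos n i y \<le> m})"
proof -
  let ?p = "cyc_pos n i"
  have p: "?p ` X \<subseteq> {1..n}" "card (?p ` X) = card X" "cnt (?p ` X) m = card {y \<in> X. ?p y \<le> m}"
    if X: "X \<subseteq> {1..n}" for X m
  proof -
    show "?p ` X \<subseteq> {1..n}" using cyc_pos_range[OF i] X by blast
    have inj: "inj_on ?p X" using cyc_pos_inj[OF i] X inj_on_subset by blast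
    then show "card (?p ` X) = card X" by (rule card_image)
    have "?p ` {y \<in> X. ?p y \<le> m} = ?p ` X \<inter> {..m}" by blast
    moreover have "card (?p ` {y \<in> X. ?p y \<le> m}) = card {y \<in> X. ?p y \<le> m}"
      by (rule card_image) (rule inj_on_subset[OF inj], blast)
    ultimately show "cnt (?p ` X) m = card {y \<in> X. ?p y \<le> m}" by (simp add: cnt_def)
  qed
  have "cyc_le i (nth_smallest i A t) (nth_smallest i B t) \<longleftrightarrow>
      cyc_le 1 (nth_smallest 1 (?p ` A) t) (nth_smallest 1 (?p ` B) t)"
    if t: "t \<in> {1..card A}" for t
  proof -
    have tB: "t \<in> {1..card B}" using t k by simp
    note a = nth_smallest_cyc_pos[OF i A t] and b = nth_smallest_cyc_pos[OF i B tB]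
    have "cyc_pos n i (nth_smallest i A t) \<in> {1..n}" "cyc_pos n i (nth_smallest i B t) \<in> {1..n}"
      using cyc_pos_range[OF i] a(1) b(1) A B by blast+
    then have "cyc_le 1 (?p (nth_smallest i A t)) (?p (nth_smallest i B t)) \<longleftrightarrow>
        ?p (nth_smallest i A t) \<le> ?p (nth_smallest i B t)"
      by (intro cyc_le_1) auto
    moreover have "nth_smallest i A t \<in> {1..n}" "nth_smallest i B t \<in> {1..n}"
      using a(1) b(1) A B by blast+
    ultimately show ?thesis using cyc_le_iff[OF i] a(2) b(2) by metis
  qed
  then have "gale_le i A B \<longleftrightarrow> gale_le 1 (?p ` A) (?p ` B)"
    using k p(2)[OF A] p(2)[OF B] by (simp add: gale_le_def)
  also have "\<dots> \<longleftrightarrow> (\<forall>m. cnt (?p ` B) m \<le> cnt (?p ` A) m)"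
    using k p(1,2)[OF A] p(1,2)[OF B] by (intro gale_le_1_iff) auto
  finally show ?thesis using p(3)[OF A] p(3)[OF B] by simp
qed

text \<open>An initial segment of the reversed order is the complement of one of the order itself,
  so with equal cardinalities the comparison flips; conecklaces thereby become first bases. Reversed
  positions start at 0, whence \<open>n - Suc m\<close> below.\<close>

lemma gale_le_rev_iff:
  assumes i: "i \<in> {1..n}" and A: "A \<subseteq> {1..n}" and B: "B \<subseteq> {1..n}" and k: "card A = card B"
  shows "gale_le i A B \<longleftrightarrow>
    (\<forall>m. card {y \<in> A. n - cyc_pos n i y \<le> m} \<le> card {y \<in> B. n - cyc_pos n i y \<le> m})"
proof -
  let ?p = "cyc_pos n i"
  have compl: "card {y \<in> X. n - ?p y \<le> m} + card {y \<in> X. ?p y \<le> n - Suc m} = card X"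
    if X: "X \<subseteq> {1..n}" and m: "m < n" for X m
  proof -
    have "n - ?p y \<le> m \<longleftrightarrow> \<not> ?p y \<le> n - Suc m" if "y \<in> X" for y
      using cyc_pos_range[OF i, of y] X that m by auto
    then have "{y \<in> X. n - ?p y \<le> m} = X - {y \<in> X. ?p y \<le> n - Suc m}" by blast
    moreover have fin: "finite X" using X finite_subset by blast
    moreover have "card {y \<in> X. ?p y \<le> n - Suc m} \<le> card X" by (rule card_mono) (use fin in auto)
    ultimately show ?thesis by (simp add: card_Diff_subset)
  qed
  have top: "{y \<in> X. ?p y \<le> m} = X" if "X \<subseteq> {1..n}" "n \<le> m" for X m
    using cyc_pos_range[OF i] that by fastforce
  have topr: "{y \<in> X. n - ?p y \<le> m} = X" if "X \<subseteq> {1..n}" "n \<le> m" for X m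
    using that by auto
  show ?thesis unfolding gale_le_iff[OF assms]
  proof (intro iffI allI)
    fix m assume *: "\<forall>m. card {y \<in> B. ?p y \<le> m} \<le> card {y \<in> A. ?p y \<le> m}"
    show "card {y \<in> A. n - ?p y \<le> m} \<le> card {y \<in> B. n - ?p y \<le> m}"
    proof (cases "m < n")
      case True
      show ?thesis
        using compl[OF A True] compl[OF B True] *[rule_format, of "n - Suc m"] k by simp
    qed (use topr A B k in simp)
  next
    fix m assume *: "\<forall>m. card {y \<in> A. n - ?p y \<le> m} \<le> card {y \<in> B. n - ?p y \<le> m}"
    show "card {y \<in> B. ?p y \<le> m} \<le> card {y \<in> A. ?p y \<le> m}"
    proof (cases "m < n")
      case True
      then have "n - Suc m < n" "n - Suc (n - Suc m) = m" by auto
      then show ?thesis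
        using compl[OF A, of "n - Suc m"] compl[OF B, of "n - Suc m"]
          *[rule_format, of "n - Suc m"] k by simp
    qed (use top A B k in simp)
  qed
qed

lemma first_basis_iff_gale_min:
  assumes M: "matroid {1..n} \<B>" and i: "i \<in> {1..n}"
  shows "first_basis (cyc_pos n i) \<B> I \<longleftrightarrow> I \<in> \<B> \<and> (\<forall>B\<in>\<B>. gale_le i I B)"
proof -
  interpret matroid "{1..n}" \<B> by (rule M)
  show ?thesis
    unfolding first_basis_def
    by (auto simp: gale_le_iff[OF i bases_subset bases_subset card_bases_eq])
qed

lemma first_basis_necklace:
  assumes M: "matroid {1..n} \<B>" and i: "i \<in> {1..n}"
  shows "first_basis (cyc_pos n i) \<B> (grassmann_necklace \<B> i)"
  unfolding grassmann_necklace_def first_basis_iff_gale_min[OF assms, symmetric]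
  by (rule theI'[OF matroid.first_basis_ex1[OF M cyc_pos_inj[OF i]]])

lemma inj_rev_cyc_pos:
  assumes "i \<in> {1..n}"
  shows "inj_on (\<lambda>x. n - cyc_pos n i x) {1..n}"
proof (rule inj_onI)
  fix x y assume xy: "x \<in> {1..n}" "y \<in> {1..n}" "n - cyc_pos n i x = n - cyc_pos n i y"
  then have "cyc_pos n i x = cyc_pos n i y"
    using cyc_pos_range[OF assms, of x] cyc_pos_range[OF assms, of y] by auto
  then show "x = y" using cyc_pos_inj[OF assms] xy by (auto dest: inj_onD)
qed

lemma first_basis_iff_gale_max:
  assumes M: "matroid {1..n} \<B>" and i: "i \<in> {1..n}"
  shows "first_basis (\<lambda>x. n - cyc_pos n i x) \<B> I \<longleftrightarrow> I \<in> \<B> \<and> (\<forall>B\<in>\<B>. gale_le i B I)"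
proof -
  interpret matroid "{1..n}" \<B> by (rule M)
  show ?thesis
    unfolding first_basis_def
    by (auto simp: gale_le_rev_iff[OF i bases_subset bases_subset card_bases_eq])
qed

lemma first_basis_conecklace:
  assumes M: "matroid {1..n} \<B>" and i: "i \<in> {1..n}"
  shows "first_basis (\<lambda>x. n - cyc_pos n i x) \<B> (grassmann_conecklace \<B> i)"
  unfolding grassmann_conecklace_def first_basis_iff_gale_max[OF assms, symmetric]
  by (rule theI'[OF matroid.first_basis_ex1[OF M inj_rev_cyc_pos[OF i]]])

section \<open>From quotients to inclusions\<close>

lemma first_basis_quotient:
  assumes Q: "matroid_quotient E \<M> \<N>" and inj: "inj_on w E"
    and "first_basis w \<M> I'" "first_basis w \<N> I"
  shows "I' \<subseteq> I"
proof -
  have M: "matroid E \<M>" and N: "matroid E \<N>"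
    and un: "\<And>C. C \<in> circuits E \<N> \<Longrightarrow> \<exists>\<C>. \<C> \<subseteq> circuits E \<M> \<and> C = \<Union>\<C>"
    using Q unfolding matroid_quotient_def by auto
  \<comment> \<open>Among the circuits of \<open>\<M>\<close> whose union is \<open>C\<close>, one
    contains \<open>e\<close>, and \<open>e\<close> is still its last element. So \<open>I'\<close>
    omits whatever \<open>I\<close> omits.\<close>
  have "\<exists>K\<in>circuits E \<M>. e \<in> K \<and> (\<forall>y\<in>K. w y \<le> w e)"
    if "C \<in> circuits E \<N>" "e \<in> C" "\<forall>y\<in>C. w y \<le> w e" for e C
    using un[OF that(1)] that(2,3) by auto
  then show ?thesis
    unfolding matroid.first_basis_eq[OF M inj assms(3)] matroid.first_basis_eq[OF N inj assms(4)]
    by blast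
qed

section \<open>Independence and necklaces of lattice path matroids\<close>

locale lattice_path_pair =
  fixes n :: nat and U L :: "nat set"
  assumes U: "U \<subseteq> {1..n}" and L: "L \<subseteq> {1..n}" and card_eq: "card L = card U"
    and cnt_le: "\<And>j. cnt L j \<le> cnt U j"
begin

abbreviation "\<B> \<equiv> lpm_bases n U L"

lemmas bases_iff = lpm_bases_iff[OF U L card_eq]

lemma U_basis: "U \<in> \<B>" and L_basis: "L \<in> \<B>"
  using bases_iff U L card_eq cnt_le by auto

lemma matroid_bases: "matroid {1..n} \<B>"
proof (rule lattice_path_matroid_matroid)
  show "lattice_path_matroid n \<B>"
    unfolding lattice_path_matroid_def
    using U L card_eq gale_le_1_iff[OF U L] cnt_le by auto
qed

text \<open>The up-steps of a lattice path between those of \<open>L\<close> and \<open>U\<close>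
  form a basis. From \<open>n\<close> on both bounds equal \<open>card U\<close>, so no step occurs
  beyond \<open>n\<close>.\<close>

lemma basis_of_path:
  assumes f0: "f 0 = 0" and step: "\<And>j. f (Suc j) = f j \<or> f (Suc j) = Suc (f j)"
    and bounds: "\<And>j. cnt L j \<le> f j" "\<And>j. f j \<le> cnt U j"
  obtains B where "B \<in> \<B>" "\<forall>j. cnt B j = f j" "\<forall>j. Suc j \<in> B \<longleftrightarrow> f (Suc j) = Suc (f j)"
proof -
  define B where "B = {j. 0 < j \<and> f j = Suc (f (j - 1))}"
  have const: "f j = card U" if "n \<le> j" for j
    using bounds[of j] cnt_top[OF U that] cnt_top[OF L that] card_eq by simp
  have "j \<le> n" if "j \<in> B" for j
  proof (rule ccontr)
    assume "\<not> ?thesis"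
    then have "f j = f (j - 1)" using const[of j] const[of "j - 1"] by simp
    then show False using that unfolding B_def by simp
  qed
  then have B: "B \<subseteq> {1..n}" unfolding B_def by auto
  have mem: "Suc j \<in> B \<longleftrightarrow> f (Suc j) = Suc (f j)" for j unfolding B_def by simp
  have cnt: "cnt B j = f j" for j
  proof (induction j)
    case 0
    then show ?case using cnt_0[OF B] f0 by simp
  next
    case (Suc j)
    then show ?case using mem[of j] step[of j] by (auto simp: cnt_Suc)
  qed
  have "card B = card U" using cnt_top[OF B, of n] cnt[of n] const[of n] by simp
  then have "B \<in> \<B>" using bases_iff B cnt bounds by simp
  then show thesis using that cnt mem by blast
qed

lemma cnt_diff_le_basis:
  assumes "B \<in> \<B>" "a \<le> b"
  shows "cnt B b + cnt L a \<le> cnt U b + cnt B a"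
  using assms bases_iff by (meson add_mono)

lemma indep_iff:
  assumes X: "X \<subseteq> {1..n}"
  shows "indep \<B> X \<longleftrightarrow> (\<forall>a b. a \<le> b \<longrightarrow> cnt X b + cnt L a \<le> cnt U b + cnt X a)"
proof
  assume "indep \<B> X"
  then obtain B where B: "B \<in> \<B>" "X \<subseteq> B" unfolding indep_def by blast
  show "\<forall>a b. a \<le> b \<longrightarrow> cnt X b + cnt L a \<le> cnt U b + cnt X a"
  proof (intro allI impI)
    fix a b :: nat assume ab: "a \<le> b"
    have "card (X \<inter> {a<..b}) \<le> card (B \<inter> {a<..b})" using B(2) by (intro card_mono) auto
    then show "cnt X b + cnt L a \<le> cnt U b + cnt X a"
      using cnt_diff_le_basis[OF B(1) ab] cnt_split[OF ab, of X] cnt_split[OF ab, of B] by simp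
  qed
next
  assume *: "\<forall>a b. a \<le> b \<longrightarrow> cnt X b + cnt L a \<le> cnt U b + cnt X a"
  \<comment> \<open>The lowest path above \<open>L\<close> that steps up at every element of \<open>X\<close>.\<close>
  define f where "f = rec_nat 0 (\<lambda>j v. max (if Suc j \<in> X then Suc v else v) (cnt L (Suc j)))"
  have f0: "f 0 = 0" and fS: "f (Suc j) = max (if Suc j \<in> X then Suc (f j) else f j) (cnt L (Suc j))" for j
    unfolding f_def by simp_all
  have lower: "cnt L j \<le> f j" for j
    by (cases j) (use cnt_0[OF L] fS in auto)
  have step: "f (Suc j) = f j \<or> f (Suc j) = Suc (f j)" for j
    using lower[of j] by (auto simp: fS cnt_Suc max_def)
  \<comment> \<open>\<open>i\<close> is the last time the path met \<open>L\<close>. Since then it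
    has risen only at elements of \<open>X\<close>, so the bound for \<open>{i<..j}\<close> keeps it
    below \<open>U\<close>.\<close>
  have reach: "\<exists>i\<le>j. f j + cnt X i = cnt L i + cnt X j" for j
  proof (induction j)
    case 0
    then show ?case using f0 cnt_0[OF L] by simp
  next
    case (Suc j)
    then obtain i where i: "i \<le> j" "f j + cnt X i = cnt L i + cnt X j" by blast
    show ?case
    proof (cases "f (Suc j) = cnt L (Suc j)")
      case True
      then show ?thesis by (intro exI[of _ "Suc j"]) simp
    next
      case False
      then have "f (Suc j) = (if Suc j \<in> X then Suc (f j) else f j)"
        unfolding fS max_def by presburger
      then show ?thesis using i by (intro exI[of _ i]) (simp add: cnt_Suc)
    qed
  qed
  have upper: "f j \<le> cnt U j" for j
  proof -
    obtain i where "i \<le> j" "f j + cnt X i = cnt L i + cnt X j" using reach by blast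
    then show ?thesis using *[rule_format, of i j] by simp
  qed
  obtain B where B: "B \<in> \<B>" "\<forall>j. Suc j \<in> B \<longleftrightarrow> f (Suc j) = Suc (f j)"
    by (rule basis_of_path[of f, OF f0 step lower upper]) blast
  have "j \<in> B" if "j \<in> X" for j
  proof -
    have "j \<noteq> 0" using that X by auto
    then obtain m where m: "j = Suc m" using not0_implies_Suc by blast
    then show ?thesis using B(2)[rule_format, of m] step[of m] that by (auto simp: fS max_def split: if_splits)
  qed
  then show "indep \<B> X" using B(1) unfolding indep_def by blast
qed

text \<open>An interval not containing \<open>C\<close> sees only a proper, hence independent, part
  of \<open>C\<close>. So a violated interval contains \<open>C\<close>, and removing one element
  shows that the excess is exactly 1.\<close>

lemma circuit_bounds:
  assumes C: "C \<in> circuits {1..n} \<B>"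
  obtains a b where "a \<le> b" "C \<subseteq> {a<..b}" "card C + cnt L a = cnt U b + 1"
    "\<forall>c d. c \<le> d \<longrightarrow> \<not> C \<subseteq> {c<..d} \<longrightarrow> cnt C d + cnt L c \<le> cnt U d + cnt C c"
proof -
  have Cn: "C \<subseteq> {1..n}" and dep: "\<not> indep \<B> C" and min: "\<And>X. X \<subset> C \<Longrightarrow> indep \<B> X"
    using C unfolding circuits_iff by auto
  have fin: "finite C" using Cn finite_subset by blast
  have sub: "card X + cnt L a \<le> cnt U b" if "indep \<B> X" "X \<subseteq> C" "X \<subseteq> {a<..b}" "a \<le> b" for X a b
  proof -
    have "X \<inter> {a<..b} = X" using that by blast
    then have "cnt X b = cnt X a + card X" using cnt_split[OF that(4), of X] by simp
    moreover have "X \<subseteq> {1..n}" using that Cn by blast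
    ultimately show ?thesis using indep_iff that(1,4) by fastforce
  qed
  have proper: "cnt C d + cnt L c \<le> cnt U d + cnt C c" if cd: "c \<le> d" "\<not> C \<subseteq> {c<..d}" for c d
  proof -
    have "card (C \<inter> {c<..d}) + cnt L c \<le> cnt U d"
      by (rule sub[OF min]) (use cd in auto)
    then show ?thesis using cnt_split[OF cd(1), of C] by simp
  qed
  obtain a b where ab: "a \<le> b" "\<not> cnt C b + cnt L a \<le> cnt U b + cnt C a"
    using dep indep_iff[OF Cn] by blast
  then have Cab: "C \<subseteq> {a<..b}" using proper by blast
  then have "C \<inter> {a<..b} = C" by blast
  then have big: "cnt U b < card C + cnt L a" using ab cnt_split[OF ab(1), of C] by simp
  have "\<exists>x. x \<in> C"
  proof (rule ccontr)
    assume "\<nexists>x. x \<in> C"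
    then have "C = {}" by blast
    then show False using dep U_basis unfolding indep_def by blast
  qed
  then obtain x where x: "x \<in> C" ..
  have "card (C - {x}) + cnt L a \<le> cnt U b"
    by (rule sub[OF min]) (use x Cab ab in auto)
  moreover have "card C = Suc (card (C - {x}))" using fin x by (rule card.remove)
  ultimately have "card C + cnt L a = cnt U b + 1" using big by simp
  then show thesis using that ab(1) Cab proper by blast
qed

section \<open>Bases meeting an interval in many or in few elements\<close>

lemma interval_rank:
  assumes ab: "a \<le> b" "b \<le> n" and r: "r \<le> b - a" "r + cnt L a \<le> cnt U b"
  obtains B where "B \<in> \<B>" "r \<le> card (B \<inter> {a<..b})"
proof -
  \<comment> \<open>Follow \<open>L\<close> up to \<open>a\<close>, then climb at every step until
    \<open>U\<close> is hit. The \<open>max\<close> with \<open>cnt L j\<close> makes the lower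
    bound immediate and changes nothing, as \<open>L\<close> climbs no faster.\<close>
  define f where "f j = (if j \<le> a then cnt L j else min (cnt U j) (max (cnt L j) (cnt L a + (j - a))))" for j
  have Lgrow: "cnt L j \<le> cnt L a + (j - a)" if "a \<le> j" for j
    using cnt_split[OF that, of L] card_mono[of "{a<..j}" "L \<inter> {a<..j}"] by simp
  have Ls: "cnt L (Suc j) = cnt L j \<or> cnt L (Suc j) = Suc (cnt L j)"
    and Us: "cnt U (Suc j) = cnt U j \<or> cnt U (Suc j) = Suc (cnt U j)" for j
    by (auto simp: cnt_Suc)
  have fa: "f j = min (cnt U j) (cnt L a + (j - a))" if "a \<le> j" for j
    using Lgrow[OF that] cnt_le[of j] that by (auto simp: f_def)
  have step: "f (Suc j) = f j \<or> f (Suc j) = Suc (f j)" for j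
  proof (cases "a \<le> j")
    case True
    then have "Suc j - a = Suc (j - a)" by simp
    then show ?thesis using fa[OF True] fa[of "Suc j"] True Us[of j] by (auto simp: min_def)
  next
    case False
    then show ?thesis using Ls[of j] by (simp add: f_def)
  qed
  have "f 0 = 0" using cnt_0[OF L] by (simp add: f_def)
  moreover have "cnt L j \<le> f j" "f j \<le> cnt U j" for j using cnt_le[of j] by (auto simp: f_def)
  ultimately obtain B where B: "B \<in> \<B>" "\<forall>j. cnt B j = f j"
    by (rule basis_of_path[of f, OF _ step])
  have "f b = min (cnt U b) (cnt L a + (b - a))" "f a = cnt L a"
    using fa ab by (auto simp: f_def)
  then have "r \<le> card (B \<inter> {a<..b})"
    using B(2)[rule_format, of a] B(2)[rule_format, of b] cnt_split[OF ab(1), of B] r by (simp add: min_def split: if_splits)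
  then show thesis using that B by blast
qed

lemma interval_corank:
  assumes dc: "d \<le> c"
  obtains B where "B \<in> \<B>" "card (B \<inter> {d<..c}) \<le> cnt L c - cnt U d"
proof -
  \<comment> \<open>Follow \<open>U\<close> up to \<open>d\<close>, then stay level until
    \<open>L\<close> forces a step; the truncated difference in the claim is 0 if this does not
    happen up to \<open>c\<close>.\<close>
  define f where "f j = (if j \<le> d then cnt U j else max (cnt L j) (cnt U d))" for j
  have Ls: "cnt L (Suc j) = cnt L j \<or> cnt L (Suc j) = Suc (cnt L j)"
    and Us: "cnt U (Suc j) = cnt U j \<or> cnt U (Suc j) = Suc (cnt U j)" for j
    by (auto simp: cnt_Suc)
  have fd: "f j = max (cnt L j) (cnt U d)" if "d \<le> j" for j
    using cnt_le[of j] that by (auto simp: f_def)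
  have step: "f (Suc j) = f j \<or> f (Suc j) = Suc (f j)" for j
  proof (cases "d \<le> j")
    case True
    then show ?thesis using fd[OF True] fd[of "Suc j"] Ls[of j] by (auto simp: max_def)
  next
    case False
    then show ?thesis using Us[of j] by (simp add: f_def)
  qed
  have mono: "cnt U d \<le> cnt U j" if "d \<le> j" for j
    using U finite_subset that by (intro cnt_mono) auto
  have "f 0 = 0" using cnt_0[OF U] by (simp add: f_def)
  moreover have "cnt L j \<le> f j" "f j \<le> cnt U j" for j
    using cnt_le[of j] mono[of j] by (auto simp: f_def)
  ultimately obtain B where B: "B \<in> \<B>" "\<forall>j. cnt B j = f j"
    by (rule basis_of_path[of f, OF _ step])
  have "f d = cnt U d" "f c = max (cnt L c) (cnt U d)" using fd dc by (auto simp: f_def)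
  then have "card (B \<inter> {d<..c}) \<le> cnt L c - cnt U d"
    using B(2)[rule_format, of c] B(2)[rule_format, of d] cnt_split[OF dc, of B] by simp
  then show thesis using that B by blast
qed

text \<open>\<open>{a<..b}\<close> is an initial segment of the order starting at
  \<open>a + 1\<close>.\<close>

lemma necklace_interval_max:
  assumes "a < n" "b \<le> n" "B \<in> \<B>"
  shows "card (B \<inter> {a<..b}) \<le> card (grassmann_necklace \<B> (Suc a) \<inter> {a<..b})"
proof (cases "a \<le> b")
  case True
  have i: "Suc a \<in> {1..n}" using assms by simp
  note fb = first_basis_necklace[OF matroid_bases i]
  have pos: "cyc_pos n (Suc a) y \<le> b - a \<longleftrightarrow> y \<in> {a<..b}" if "y \<in> {1..n}" for y
    using that assms(1,2) True by (auto simp: cyc_pos_def)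
  have eq: "{y \<in> X. cyc_pos n (Suc a) y \<le> b - a} = X \<inter> {a<..b}" if "X \<in> \<B>" for X
    using that bases_iff[of X] pos by blast
  have "grassmann_necklace \<B> (Suc a) \<in> \<B>" using fb unfolding first_basis_def by simp
  moreover have "card {y \<in> B. cyc_pos n (Suc a) y \<le> b - a}
      \<le> card {y \<in> grassmann_necklace \<B> (Suc a). cyc_pos n (Suc a) y \<le> b - a}"
    using fb assms(3) unfolding first_basis_def by simp
  ultimately show ?thesis using eq assms(3) by simp
qed simp

text \<open>\<open>{d<..c}\<close> is a final segment of the order starting at \<open>c + 1\<close>,
  and its complement is the first \<open>n - c + d\<close> positions. Bases have equal size, so most
  elements there means fewest in the interval.\<close>

lemma necklace_interval_min:
  assumes dc: "d \<le> c" "c < n" and B: "B \<in> \<B>"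
  shows "card (grassmann_necklace \<B> (Suc c) \<inter> {d<..c}) \<le> card (B \<inter> {d<..c})"
proof -
  have i: "Suc c \<in> {1..n}" using assms by simp
  let ?I = "grassmann_necklace \<B> (Suc c)"
  note fb = first_basis_necklace[OF matroid_bases i]
  have eq: "card {y \<in> X. cyc_pos n (Suc c) y \<le> n - c + d} + card (X \<inter> {d<..c}) = card U"
    if X: "X \<in> \<B>" for X
  proof -
    have Xn: "X \<subseteq> {1..n}" "card X = card U" using X bases_iff by auto
    have "cyc_pos n (Suc c) y \<le> n - c + d \<longleftrightarrow> y \<notin> {d<..c}" if "y \<in> {1..n}" for y
      using that dc by (auto simp: cyc_pos_def)
    then have "{y \<in> X. cyc_pos n (Suc c) y \<le> n - c + d} = X - (X \<inter> {d<..c})"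
      using Xn(1) by blast
    moreover have fin: "finite X" using Xn finite_subset by blast
    moreover have "card (X \<inter> {d<..c}) \<le> card X" by (rule card_mono) (use fin in auto)
    ultimately show ?thesis using Xn by (simp add: card_Diff_subset)
  qed
  have "?I \<in> \<B>" "card {y \<in> B. cyc_pos n (Suc c) y \<le> n - c + d}
      \<le> card {y \<in> ?I. cyc_pos n (Suc c) y \<le> n - c + d}"
    using fb B unfolding first_basis_def by auto
  then show ?thesis using eq[OF B] eq[of ?I] by simp
qed

lemma necklace_basis: "a < n \<Longrightarrow> grassmann_necklace \<B> (Suc a) \<in> \<B>"
  using first_basis_necklace[OF matroid_bases, of "Suc a"] unfolding first_basis_def by simp

lemma necklace_1:
  assumes "1 \<le> n"
  shows "grassmann_necklace \<B> 1 = U"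
proof -
  interpret matroid "{1..n}" \<B> by (rule matroid_bases)
  have i: "1 \<in> {1..n}" using assms by simp
  have "gale_le 1 U B" if "B \<in> \<B>" for B using that unfolding lpm_bases_def by simp
  then have "first_basis (cyc_pos n 1) \<B> U"
    unfolding first_basis_iff_gale_min[OF matroid_bases i] using U_basis by blast
  then show ?thesis
    by (rule first_basis_unique[OF cyc_pos_inj[OF i] first_basis_necklace[OF matroid_bases i]])
qed

lemma conecklace_1:
  assumes "1 \<le> n"
  shows "grassmann_conecklace \<B> 1 = L"
proof -
  interpret matroid "{1..n}" \<B> by (rule matroid_bases)
  have i: "1 \<in> {1..n}" using assms by simp
  have "gale_le 1 B L" if "B \<in> \<B>" for B using that unfolding lpm_bases_def by simp
  then have "first_basis (\<lambda>x. n - cyc_pos n 1 x) \<B> L"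
    unfolding first_basis_iff_gale_max[OF matroid_bases i] using L_basis by blast
  then show ?thesis
    by (rule first_basis_unique[OF inj_rev_cyc_pos[OF i] first_basis_conecklace[OF matroid_bases i]])
qed

end

lemma lattice_path_matroidE:
  assumes "lattice_path_matroid n \<B>"
  obtains U L where "lattice_path_pair n U L" "\<B> = lpm_bases n U L"
proof -
  obtain U L where UL: "U \<subseteq> {1..n}" "L \<subseteq> {1..n}" "card L = card U" "gale_le 1 U L"
    and eq: "\<B> = lpm_bases n U L"
    using assms unfolding lattice_path_matroid_def by auto
  have "\<And>j. cnt L j \<le> cnt U j" using UL gale_le_1_iff[of U n L] by simp
  then have "lattice_path_pair n U L" using UL by unfold_locales auto
  then show thesis using that eq by blast
qed

lemma cnt_subset_diff:
  assumes "A \<subseteq> B" "j \<le> j'"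
  shows "cnt A j' + cnt B j \<le> cnt B j' + cnt A j"
proof -
  have "card (A \<inter> {j<..j'}) \<le> card (B \<inter> {j<..j'})" using assms by (intro card_mono) auto
  then show ?thesis using cnt_split[OF assms(2), of A] cnt_split[OF assms(2), of B] by simp
qed

section \<open>Necklace inclusions imply the quotient relation\<close>

locale necklace_inclusion =
  N: lattice_path_pair n U L + N': lattice_path_pair n U' L'
  for n U L U' L' +
  assumes U_sub: "U' \<subseteq> U" and L_sub: "L' \<subseteq> L"
    and necklace_sub: "\<And>i. i \<in> {1..n} \<Longrightarrow>
      grassmann_necklace (lpm_bases n U' L') i \<subseteq> grassmann_necklace (lpm_bases n U L) i"
begin

text \<open>Otherwise \<open>N'\<close> has a basis with more than \<open>cnt U b - cnt L a\<close>
  elements in \<open>{a<..b}\<close>, whose length leaves room for one more. The necklace member of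
  \<open>N'\<close> at \<open>a + 1\<close> has as many, and its inclusion in that of
  \<open>N\<close> breaks the interval bound of \<open>N\<close>.\<close>

lemma interval_rank_le:
  assumes ab: "a \<le> b" "b \<le> n" and r: "cnt U b - cnt L a < b - a" "cnt L a \<le> cnt U b"
  shows "cnt U' b + cnt L a \<le> cnt U b + cnt L' a"
proof (rule ccontr)
  assume *: "\<not> ?thesis"
  let ?r = "Suc (cnt U b - cnt L a)"
  have a: "a < n" using ab r by simp
  have "?r + cnt L' a \<le> cnt U' b" "?r \<le> b - a" using * r by auto
  then obtain B where B: "B \<in> N'.\<B>" "?r \<le> card (B \<inter> {a<..b})"
    using N'.interval_rank[OF ab] by blast
  have "card (B \<inter> {a<..b}) \<le> card (grassmann_necklace N'.\<B> (Suc a) \<inter> {a<..b})"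
    using N'.necklace_interval_max[OF a ab(2) B(1)] .
  also have "\<dots> \<le> card (grassmann_necklace N.\<B> (Suc a) \<inter> {a<..b})"
    using necklace_sub[of "Suc a"] a by (intro card_mono) auto
  also have "\<dots> \<le> cnt U b - cnt L a"
    using N.cnt_diff_le_basis[OF N.necklace_basis[OF a] ab(1)]
      cnt_split[OF ab(1), of "grassmann_necklace N.\<B> (Suc a)"] by simp
  finally show False using B(2) by simp
qed

text \<open>Dual estimate: the paths force \<open>cnt L' c - cnt U' d\<close> elements of the
  \<open>N'\<close> necklace member at \<open>c + 1\<close> into the interval, while that of
  \<open>N\<close> has at most \<open>cnt L c - cnt U d\<close> there. By \<open>pos\<close> both
  truncated differences are genuine.\<close>

lemma interval_corank_le:
  assumes dc: "d \<le> c" "c < n" and pos: "cnt U' d < cnt L' c"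
  shows "cnt U d + cnt L' c \<le> cnt U' d + cnt L c"
proof -
  let ?I = "grassmann_necklace N.\<B> (Suc c)" and ?I' = "grassmann_necklace N'.\<B> (Suc c)"
  obtain B where B: "B \<in> N.\<B>" "card (B \<inter> {d<..c}) \<le> cnt L c - cnt U d"
    using N.interval_corank[OF dc(1)] .
  have "cnt L' c \<le> cnt ?I' c" "cnt ?I' d \<le> cnt U' d"
    using N'.necklace_basis[OF dc(2)] N'.bases_iff by auto
  then have "cnt L' c - cnt U' d \<le> card (?I' \<inter> {d<..c})"
    using cnt_split[OF dc(1), of ?I'] by simp
  also have "\<dots> \<le> card (?I \<inter> {d<..c})"
    using necklace_sub[of "Suc c"] dc by (intro card_mono) auto
  also have "\<dots> \<le> cnt L c - cnt U d"
    using N.necklace_interval_min[OF dc B(1)] B(2) by simp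
  finally show ?thesis using pos by simp
qed

lemma circuit_covered:
  assumes C: "C \<in> circuits {1..n} N.\<B>" and e: "e \<in> C"
  shows "\<exists>K\<in>circuits {1..n} N'.\<B>. e \<in> K \<and> K \<subseteq> C"
proof (rule ccontr)
  assume none: "\<not> ?thesis"
  have Cn: "C \<subseteq> {1..n}" using C unfolding circuits_iff by simp
  have fin: "finite C" using Cn finite_subset by blast
  obtain a b0 where ab0: "a \<le> b0" "C \<subseteq> {a<..b0}" "card C + cnt L a = cnt U b0 + 1"
    and proper: "\<forall>c d. c \<le> d \<longrightarrow> \<not> C \<subseteq> {c<..d} \<longrightarrow> cnt C d + cnt L c \<le> cnt U d + cnt C c"
    using N.circuit_bounds[OF C] .
  \<comment> \<open>The path of \<open>U\<close> is constant from \<open>n\<close> on, so the right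
    end can be capped as the interval estimates require.\<close>
  define b where "b = min b0 n"
  have Cab: "C \<subseteq> {a<..b}" using subsetD[OF ab0(2)] subsetD[OF Cn] by (auto simp: b_def)
  have ab: "a \<le> b" "b \<le> n" using Cab e by (force simp: b_def)+
  have "cnt U b0 = cnt U b"
    using cnt_top[OF N.U, of b0] cnt_top[OF N.U, of n] by (cases "b0 \<le> n") (auto simp: b_def)
  then have card_C: "card C + cnt L a = cnt U b + 1" using ab0 by simp
  \<comment> \<open>Maximality is imposed inside \<open>C - {e}\<close>: each
    \<open>f \<in> C - X\<close> is then dependent together with \<open>Y\<close> alone, which later
    keeps \<open>e\<close> out of its tight interval.\<close>
  have "finite {Y. Y \<subseteq> C - {e} \<and> indep N'.\<B> Y}" using fin by simp
  moreover have "{} \<in> {Y. Y \<subseteq> C - {e} \<and> indep N'.\<B> Y}"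
    using N'.U_basis unfolding indep_def by auto
  ultimately obtain Y where Y: "Y \<in> {Y. Y \<subseteq> C - {e} \<and> indep N'.\<B> Y}"
    and Y_max: "\<And>Z. Z \<in> {Y. Y \<subseteq> C - {e} \<and> indep N'.\<B> Y} \<Longrightarrow> Y \<subseteq> Z \<Longrightarrow> Y = Z"
    using finite_has_maximal2[of "{Y. Y \<subseteq> C - {e} \<and> indep N'.\<B> Y}" "{}"] by (metis (lifting))
  then have YC: "Y \<subseteq> C - {e}" "indep N'.\<B> Y" by auto
  define X where "X = insert e Y"
  have XC: "X \<subseteq> C" and eX: "e \<in> X" using YC e unfolding X_def by auto
  have Xn: "X \<subseteq> {1..n}" and Yn: "Y \<subseteq> {1..n}" using XC YC Cn by auto
  have finX: "finite X" using XC fin finite_subset by blast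
  have indX: "indep N'.\<B> X"
  proof (rule ccontr)
    assume "\<not> ?thesis"
    then obtain K where K: "K \<in> circuits {1..n} N'.\<B>" "K \<subseteq> X"
      by (rule dependent_contains_circuit[OF finite_atLeastAtMost Xn])
    have "\<not> K \<subseteq> Y" using K(1) indep_mono[OF YC(2), of K] unfolding circuits_iff by blast
    then show False using K XC none unfolding X_def by blast
  qed
  have X_le: "cnt X d + cnt L' c \<le> cnt U' d + cnt X c" if "c \<le> d" for c d
    using N'.indep_iff[OF Xn] indX that by blast
  have mono: "cnt X c \<le> cnt X d" "cnt U' c \<le> cnt U' d" "cnt L' c \<le> cnt L' d" if "c \<le> d" for c d
    using that finX N'.U N'.L finite_subset by (auto intro!: cnt_mono)
  have e_between: "cnt X c < cnt X d" if "e \<in> {c<..d}" for c d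
    using that cnt_strict[OF finX eX, of c] cnt_mono[OF finX, of e d] by auto
  define T where "T c d \<longleftrightarrow> a \<le> c \<and> c < d \<and> d \<le> b \<and> e \<notin> {c<..d} \<and>
    cnt X d + cnt L' c = cnt U' d + cnt X c" for c d
  have covered: "\<exists>c d. T c d \<and> f \<in> {c<..d}" if f: "f \<in> C - X" for f
  proof -
    have fY: "f \<notin> Y" "f \<noteq> e" "f \<in> C" using f unfolding X_def by auto
    then have "\<not> indep N'.\<B> (insert f Y)" using Y_max[of "insert f Y"] YC by blast
    moreover have "insert f Y \<subseteq> {1..n}" using Yn Cn fY by auto
    ultimately obtain c d where cd: "c \<le> d"
      "cnt U' d + cnt (insert f Y) c < cnt (insert f Y) d + cnt L' c"
      using N'.indep_iff by (meson not_le)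
    have Y_le: "cnt Y d + cnt L' c \<le> cnt U' d + cnt Y c"
      using N'.indep_iff[OF Yn] YC(2) cd(1) by blast
    have ins: "insert g Y \<inter> {c<..d} = (if g \<in> {c<..d} then insert g (Y \<inter> {c<..d}) else Y \<inter> {c<..d})" for g
      by auto
    have cnt_ins: "cnt (insert g Y) d + cnt Y c = cnt (insert g Y) c + cnt Y d + (if g \<in> {c<..d} then 1 else 0)"
      if "g \<notin> Y" for g
      using cnt_split[OF cd(1), of "insert g Y"] cnt_split[OF cd(1), of Y] ins[of g] that by simp
    \<comment> \<open>\<open>Y\<close> obeys the bound, so the violation needs \<open>f\<close>, and
      \<open>Y\<close> already attains the bound. With \<open>e\<close> in the interval,
      \<open>X\<close> would exceed it.\<close>
    have fcd: "f \<in> {c<..d}"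
      using cnt_ins[OF fY(1)] cd(2) Y_le by (auto split: if_splits)
    have eY: "e \<notin> Y" using YC by blast
    have ecd: "e \<notin> {c<..d}" and tight: "cnt X d + cnt L' c = cnt U' d + cnt X c"
      using cnt_ins[OF fY(1)] cnt_ins[OF eY] cd(2) X_le[OF cd(1)] fcd
      unfolding X_def[symmetric] by (auto split: if_splits)
    \<comment> \<open>Clipping to \<open>{a<..b}\<close> loses no element of \<open>X\<close>, while
      the bound can only shrink, so tightness survives.\<close>
    let ?c = "max a c" and ?d = "min b d"
    have fab: "f \<in> {a<..b}" using Cab fY by blast
    have le: "?c \<le> ?d" using fab fcd by auto
    have "X \<inter> {?c<..?d} = X \<inter> {c<..d}" using XC Cab by auto
    then have "cnt X ?d + cnt X c = cnt X ?c + cnt X d"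
      using cnt_split[OF le, of X] cnt_split[OF cd(1), of X] by simp
    moreover have "cnt L' c \<le> cnt L' ?c" "cnt U' ?d \<le> cnt U' d"
      by (rule mono; simp)+
    ultimately have "cnt X ?d + cnt L' ?c = cnt U' ?d + cnt X ?c"
      using X_le[OF le] tight by linarith
    moreover have "f \<in> {?c<..?d}" using fab fcd by auto
    ultimately have "T ?c ?d \<and> f \<in> {?c<..?d}" using ecd unfolding T_def by auto
    then show ?thesis by blast
  qed
  have cnt_C: "cnt C j = cnt X j + cnt (C - X) j" for j
  proof -
    have "C \<inter> {..j} = (X \<inter> {..j}) \<union> ((C - X) \<inter> {..j})" using XC by blast
    then show ?thesis unfolding cnt_def by (simp add: card_Un_disjoint disjoint_iff)
  qed
  have bound: "cnt (C - X) d + cnt L a + cnt U' d \<le> cnt U d + cnt L' a" if "T c0 d" for c0 d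
    using that
  proof (induction d arbitrary: c0 rule: less_induct)
    case (less d)
    \<comment> \<open>With the leftmost start chosen, any longer tight interval ending at
      \<open>d\<close> is a contradiction.\<close>
    define c where "c = (LEAST c. T c d)"
    have Tc: "T c d" unfolding c_def by (rule LeastI[of "\<lambda>c. T c d", OF less.prems])
    have c_min: "c \<le> c'" if "T c' d" for c' unfolding c_def using that by (rule Least_le)
    have c: "a \<le> c" "c \<le> d" "d \<le> b" "e \<notin> {c<..d}" "cnt X d + cnt L' c = cnt U' d + cnt X c"
      using Tc unfolding T_def by auto
    \<comment> \<open>The interval misses \<open>e\<close>, so it does not contain \<open>C\<close>
      and the bound of \<open>N\<close> holds; tightness then subtracts the share of
      \<open>X\<close>.\<close>
    have "cnt C d + cnt L c \<le> cnt U d + cnt C c" using proper c(2,4) e by blast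
    then have last: "cnt (C - X) d + cnt L c + cnt U' d \<le> cnt U d + cnt L' c + cnt (C - X) c"
      using c(5) cnt_C[of c] cnt_C[of d] by linarith
    show ?case
    proof (cases "(C - X) \<inter> {..c} = {}")
      case True
      then have "cnt (C - X) c = 0" by (simp add: cnt_def)
      then show ?thesis using last cnt_subset_diff[OF L_sub c(1)] by linarith
    next
      case False
      define f where "f = Max ((C - X) \<inter> {..c})"
      have "f \<in> (C - X) \<inter> {..c}" unfolding f_def using False by (intro Max_in) auto
      then have f: "f \<in> C - X" "f \<le> c" by auto
      obtain c' d' where T': "T c' d'" "f \<in> {c'<..d'}" using covered[OF f(1)] by blast
      then have c': "a \<le> c'" "c' \<le> d'" "d' \<le> b" "e \<notin> {c'<..d'}"
        "cnt X d' + cnt L' c' = cnt U' d' + cnt X c'" "c' < c"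
        using f(2) unfolding T_def by auto
      \<comment> \<open>Overlapping tight intervals, and those with \<open>cnt L' c \<le> cnt U' d'\<close>, merge into a longer one.\<close>
      have no_merge: "\<not> T c' d" using c_min c'(6) by force
      have d'c: "d' < c"
      proof (rule ccontr)
        assume "\<not> ?thesis"
        then have cd': "c \<le> d'" by simp
        \<comment> \<open>Uncrossing: add the two equalities and subtract the bound for the overlap
          \<open>{c<..d'}\<close>.\<close>
        have "cnt X d + cnt L' c' = cnt U' d + cnt X c'"
          using X_le[OF cd'] X_le[of c' d] c' c by linarith
        moreover have "e \<notin> {c'<..d}" using c'(4) c(4) cd' by auto
        ultimately show False using no_merge c c' unfolding T_def by auto
      qed
      have "cnt U' d' < cnt L' c"
      proof (rule ccontr)
        assume *: "\<not> ?thesis"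
        have "cnt X d' \<le> cnt X c" using mono d'c by simp
        \<comment> \<open>\<open>X\<close> cannot exceed the bound for \<open>{c'<..d}\<close>, so
          all estimates are equalities; thus \<open>X\<close>, and with it \<open>e\<close>, avoids
          the gap \<open>{d'<..c}\<close>.\<close>
        then have eqs: "cnt X d + cnt L' c' = cnt U' d + cnt X c'" "cnt X d' = cnt X c"
          using * X_le[of c' d] c' c by linarith+
        have "e \<notin> {d'<..c}" using e_between[of d' c] eqs(2) by auto
        then have "e \<notin> {c'<..d}" using c'(4) c(4) by auto
        then show False using no_merge eqs(1) c c' unfolding T_def by auto
      qed
      moreover have "c < n"
        using c(3) ab(2) Tc unfolding T_def by simp
      \<comment> \<open>The link of the chain: the surplus of \<open>U\<close> over
        \<open>U'\<close> at \<open>d'\<close> is at most that of \<open>L\<close> over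
        \<open>L'\<close> at \<open>c\<close>, so the estimate for \<open>d'\<close> feeds into
        \<open>last\<close>.\<close>
      ultimately have key: "cnt U d' + cnt L' c \<le> cnt U' d' + cnt L c"
        using interval_corank_le d'c by simp
      have "(C - X) \<inter> {d'<..c} = {}"
      proof (rule ccontr)
        assume "\<not> ?thesis"
        then obtain g where "g \<in> (C - X) \<inter> {..c}" "d' < g" by force
        moreover from this have "g \<le> f" unfolding f_def by (intro Max_ge) auto
        ultimately show False using T'(2) by simp
      qed
      then have "cnt (C - X) c = cnt (C - X) d'"
        using cnt_split[of d' c "C - X"] d'c by simp
      moreover have "d' < d" using d'c c(2) by simp
      ultimately show ?thesis using less.IH[OF _ T'(1)] last key by linarith
    qed
  qed
  have X_eq: "cnt X b = card X" "cnt X a = 0" "cnt C b = card C"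
  proof -
    have "X \<inter> {..b} = X" "X \<inter> {..a} = {}" "C \<inter> {..b} = C" using XC Cab by force+
    then show "cnt X b = card X" "cnt X a = 0" "cnt C b = card C" by (simp_all add: cnt_def)
  qed
  have card_X: "card X + cnt L' a \<le> cnt U' b" using X_le[OF ab(1)] X_eq by simp
  have card_diff: "card C = card X + card (C - X)"
    using XC fin finX card_mono[OF fin XC] by (simp add: card_Diff_subset)
  show False
  proof (cases "C - X = {}")
    case True
    \<comment> \<open>Here \<open>C\<close> itself is independent in \<open>N'\<close>. Its
      \<open>cnt U b - cnt L a + 1\<close> elements fit into \<open>{a<..b}\<close>, so the rank
      estimate applies.\<close>
    have "card C \<le> b - a" using card_mono[OF _ Cab] by simp
    moreover have "card C \<noteq> 0" using e fin by auto
    ultimately have "cnt U' b + cnt L a \<le> cnt U b + cnt L' a"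
      using card_C by (intro interval_rank_le[OF ab]) auto
    moreover have "card (C - X) = 0" using True by (simp only: card.empty)
    ultimately show False using card_X card_C card_diff by linarith
  next
    case False
    \<comment> \<open>A tight interval around the last element of \<open>C - X\<close> ends after
      all of \<open>C - X\<close>; from its end to \<open>b\<close> the inclusion
      \<open>U' \<subseteq> U\<close> completes the estimate.\<close>
    define f where "f = Max (C - X)"
    have "f \<in> C - X" unfolding f_def using False fin by (intro Max_in) auto
    then obtain c d where T: "T c d" "f \<in> {c<..d}" using covered by blast
    have "g \<le> d" if "g \<in> C - X" for g
    proof -
      have "g \<le> f" unfolding f_def using that fin by (intro Max_ge) auto
      then show ?thesis using T(2) by simp
    qed
    then have "(C - X) \<inter> {..d} = C - X" by blast
    then have "cnt (C - X) d = card (C - X)" by (simp add: cnt_def)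
    moreover have "d \<le> b" using T(1) unfolding T_def by simp
    ultimately show False
      using bound[OF T(1)] cnt_subset_diff[OF U_sub \<open>d \<le> b\<close>] card_X card_C card_diff by linarith
  qed
qed

end

theorem theorem5p6:
  fixes n :: nat and N' N :: "nat set set"
  assumes "lattice_path_matroid n N'"
    and "lattice_path_matroid n N"
  shows "matroid_quotient {1..n} N' N \<longleftrightarrow>
    (\<forall>i\<in>{1..n}. grassmann_necklace N' i \<subseteq> grassmann_necklace N i \<and>
                 grassmann_conecklace N' i \<subseteq> grassmann_conecklace N i)"
proof
  note M = assms[THEN lattice_path_matroid_matroid]
  assume "matroid_quotient {1..n} N' N"
  note sub = first_basis_quotient[OF this]
  show "\<forall>i\<in>{1..n}. grassmann_necklace N' i \<subseteq> grassmann_necklace N i \<and>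
                 grassmann_conecklace N' i \<subseteq> grassmann_conecklace N i"
    using sub[OF cyc_pos_inj first_basis_necklace[OF M(1)] first_basis_necklace[OF M(2)]]
      sub[OF inj_rev_cyc_pos first_basis_conecklace[OF M(1)] first_basis_conecklace[OF M(2)]]
    by simp
next
  note M = assms[THEN lattice_path_matroid_matroid]
  assume incl: "\<forall>i\<in>{1..n}. grassmann_necklace N' i \<subseteq> grassmann_necklace N i \<and>
                 grassmann_conecklace N' i \<subseteq> grassmann_conecklace N i"
  obtain U L where UL: "lattice_path_pair n U L" "N = lpm_bases n U L"
    using lattice_path_matroidE[OF assms(2)] .
  obtain U' L' where UL': "lattice_path_pair n U' L'" "N' = lpm_bases n U' L'"
    using lattice_path_matroidE[OF assms(1)] .
  interpret A: lattice_path_pair n U L by (rule UL(1))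
  interpret A': lattice_path_pair n U' L' by (rule UL'(1))
  \<comment> \<open>\<open>U\<close> and \<open>L\<close> are the necklace and conecklace members at
    1; for \<open>n = 0\<close> the primed sets are empty.\<close>
  have "U' \<subseteq> U \<and> L' \<subseteq> L"
  proof (cases "1 \<le> n")
    case True
    then have "1 \<in> {1..n}" by simp
    then show ?thesis
      using incl UL(2) UL'(2) A.necklace_1[OF True] A'.necklace_1[OF True]
        A.conecklace_1[OF True] A'.conecklace_1[OF True] by metis
  next
    case False
    then show ?thesis using A'.U A'.L by simp
  qed
  then interpret necklace_inclusion n U L U' L'
    using incl UL(2) UL'(2) by unfold_locales auto
  have "\<exists>\<C>. \<C> \<subseteq> circuits {1..n} N' \<and> C = \<Union>\<C>" if "C \<in> circuits {1..n} N" for C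
  proof (intro exI conjI)
    show "{K \<in> circuits {1..n} N'. K \<subseteq> C} \<subseteq> circuits {1..n} N'" by blast
    show "C = \<Union>{K \<in> circuits {1..n} N'. K \<subseteq> C}"
      using circuit_covered that UL(2) UL'(2) by blast
  qed
  then show "matroid_quotient {1..n} N' N" using M unfolding matroid_quotient_def by blast
qed

end
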